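(* If $p:M(\mathbb{C})^g\to M(\mathbb{C})^g$ is a bijective free polynomial mapping with left Jacobian matrix $J_p$, then $J_p^{-1}$ is a polynomial matrix; that is, $J_p$ is invertible in $M_g(\mathbb{C}\langle x_1,\dots,x_g\rangle)$.
   Context: $x=(x_1,\dots,x_g)$ is a row vector of freely noncommuting indeterminates. A free polynomial mapping $p=(p^1,\dots,p^g):M(\mathbb{C})^g\to M(\mathbb{C})^g$ is a $g$-tuple of elements of the free associative algebra $\mathbb{C}\langle x_1,\dots,x_g\rangle$, inducing by evaluation maps $p[n]:M_n(\mathbb{C})^g\to M_n(\mathbb{C})^g$ for every $n\ge1$; it is bijective if every $p[n]$ is bijective. The left Jacobian matrix $J_p$ is the unique $g\times g$ matrix with entries in $\mathbb{C}\langle x_1,\dots,x_g\rangle$ such that $p(x)=p(0)+xJ_p(x)$, i.e. $p^j(x)=p^j(0)+\sum_{s=1}^g x_s(J_p)_{s,j}(x)$, where $p(0)$ is the tuple of constant terms. *)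

theory Defs
  imports
    "HOL-Analysis.Analysis"
    "HOL-Library.Poly_Mapping"
    "Jordan_Normal_Form.Matrix"
begin

no_notation vec_index (infixl \<open>$\<close> 100)

section \<open>The free associative algebra\<close>

text \<open>
  The free monoid on \<open>'g\<close> is the type of words with concatenation; it is written additively
  because the convolution product of \<^type>\<open>poly_mapping\<close> expects an additive monoid of exponents.
  The free algebra over the complex numbers is then the monoid algebra of \<open>'g fword\<close>, with the
  (noncommutative) ring structure that the library puts on \<^type>\<open>poly_mapping\<close>.
  The indeterminates \<open>x\<^sub>1, \<dots>, x\<^sub>g\<close> are indexed by a finite type \<open>'g\<close>, so that \<open>g = CARD('g) \<ge> 1\<close>.
\<close>

datatype 'g fword = Word (letters: "'g list")

instantiation fword :: (type) monoid_add
begin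

definition zero_fword :: "'a fword" where
  "0 = Word []"

definition plus_fword :: "'a fword \<Rightarrow> 'a fword \<Rightarrow> 'a fword" where
  "u + v = Word (letters u @ letters v)"

instance
  by standard (simp_all add: zero_fword_def plus_fword_def)

end

type_synonym 'g free_alg = "'g fword \<Rightarrow>\<^sub>0 complex"

definition indet :: "'g \<Rightarrow> 'g free_alg" where
  "indet s = Poly_Mapping.single (Word [s]) 1"

definition const_term :: "'g free_alg \<Rightarrow> 'g free_alg" where
  "const_term f = Poly_Mapping.single 0 (Poly_Mapping.lookup f 0)"

section \<open>Evaluation at tuples of matrices\<close>

definition mat_tuples :: "nat \<Rightarrow> ('g \<Rightarrow> complex mat) set" where
  "mat_tuples n = {X. \<forall>s. X s \<in> carrier_mat n n}"

definition eval_word :: "nat \<Rightarrow> ('g \<Rightarrow> complex mat) \<Rightarrow> 'g fword \<Rightarrow> complex mat" where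
  "eval_word n X w = foldr (\<lambda>s A. X s * A) (letters w) (1\<^sub>m n)"

text \<open>
  Matrices of variable size form no type class instance, so the finite linear combination
  of the matrices \<open>eval_word n X w\<close> is taken entrywise.
\<close>

definition eval_free :: "nat \<Rightarrow> ('g \<Rightarrow> complex mat) \<Rightarrow> 'g free_alg \<Rightarrow> complex mat" where
  "eval_free n X f = Matrix.mat n n
     (\<lambda>ij. \<Sum>w\<in>Poly_Mapping.keys f. Poly_Mapping.lookup f w * (eval_word n X w $$ ij))"

definition eval_map :: "('g \<Rightarrow> 'g free_alg) \<Rightarrow> nat \<Rightarrow> ('g \<Rightarrow> complex mat) \<Rightarrow> ('g \<Rightarrow> complex mat)"
  where "eval_map p n X = (\<lambda>j. eval_free n X (p j))"

definition bijective_free_map :: "('g \<Rightarrow> 'g free_alg) \<Rightarrow> bool" where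
  "bijective_free_map p \<longleftrightarrow> (\<forall>n\<ge>1. bij_betw (eval_map p n) (mat_tuples n) (mat_tuples n))"

lemma eval_map_mat_tuples: "eval_map p n X \<in> mat_tuples n"
  by (simp add: eval_map_def eval_free_def mat_tuples_def)

lemma eval_word_simps:
  "eval_word n X 0 = 1\<^sub>m n"
  "eval_word n X (Word (s # w)) = X s * eval_word n X (Word w)"
  by (simp_all add: eval_word_def zero_fword_def)

lemma eval_free_indet:
  assumes "X \<in> mat_tuples n"
  shows "eval_free n X (indet s) = X s"
proof -
  have "X s \<in> carrier_mat n n"
    using assms by (simp add: mat_tuples_def)
  then show ?thesis
    by (auto simp: eval_free_def indet_def eval_word_def)
qed

section \<open>The left Jacobian matrix\<close>

definition is_left_jacobian ::
    "('g::finite \<Rightarrow> 'g free_alg) \<Rightarrow> 'g free_alg ^ 'g ^ 'g \<Rightarrow> bool" where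
  "is_left_jacobian p J \<longleftrightarrow>
     (\<forall>j. p j = const_term (p j) + (\<Sum>s\<in>UNIV. indet s * J $ s $ j))"

definition left_jacobian :: "('g::finite \<Rightarrow> 'g free_alg) \<Rightarrow> 'g free_alg ^ 'g ^ 'g" where
  "left_jacobian p = (THE J. is_left_jacobian p J)"

lemma lookup_indet_mult:
  "Poly_Mapping.lookup (indet s * f) (Word w) =
     (case w of [] \<Rightarrow> 0 | t # v \<Rightarrow> if t = s then Poly_Mapping.lookup f (Word v) else 0)"
proof -
  have eq: "Word w = Word [s] + q \<longleftrightarrow> (\<exists>v. w = s # v \<and> q = Word v)" for q
    by (cases q) (auto simp: plus_fword_def)
  have "Poly_Mapping.lookup (indet s * f) (Word w) =
      (\<Sum>q. Poly_Mapping.lookup f q when Word w = Word [s] + q)"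
    by (simp add: lookup_mult indet_def lookup_single when_mult mult_when)
  also have "\<dots> = (case w of [] \<Rightarrow> 0 | t # v \<Rightarrow> if t = s then Poly_Mapping.lookup f (Word v) else 0)"
    unfolding eq by (auto split: list.split)
  finally show ?thesis .
qed

lemma is_left_jacobian_iff:
  "is_left_jacobian p J \<longleftrightarrow>
     (\<forall>s j w. Poly_Mapping.lookup (J $ s $ j) (Word w) = Poly_Mapping.lookup (p j) (Word (s # w)))"
proof -
  have rhs: "Poly_Mapping.lookup (const_term (p j) + (\<Sum>s\<in>UNIV. indet s * J $ s $ j)) (Word w) =
      (case w of [] \<Rightarrow> Poly_Mapping.lookup (p j) (Word [])
        | s # v \<Rightarrow> Poly_Mapping.lookup (J $ s $ j) (Word v))" for j w
    by (auto simp: lookup_add lookup_sum lookup_indet_mult const_term_def lookup_single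
        zero_fword_def split: list.split)
  have "p j = q \<longleftrightarrow> (\<forall>w. Poly_Mapping.lookup (p j) (Word w) = Poly_Mapping.lookup q (Word w))" for j q
    by (metis fword.exhaust poly_mapping_eqI)
  then have "is_left_jacobian p J \<longleftrightarrow> (\<forall>j w. Poly_Mapping.lookup (p j) (Word w) =
      (case w of [] \<Rightarrow> Poly_Mapping.lookup (p j) (Word [])
        | s # v \<Rightarrow> Poly_Mapping.lookup (J $ s $ j) (Word v)))"
    unfolding is_left_jacobian_def by (simp add: rhs)
  also have "\<dots> \<longleftrightarrow>
      (\<forall>s j w. Poly_Mapping.lookup (J $ s $ j) (Word w) = Poly_Mapping.lookup (p j) (Word (s # w)))"
    by (auto split: list.split)
  finally show ?thesis .
qed

lemma ex1_left_jacobian: "\<exists>!J. is_left_jacobian p J"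
proof (rule ex_ex1I)
  define c where "c s j w = Poly_Mapping.lookup (p j) (Word [s] + w)" for s j w
  have "finite {w. c s j w \<noteq> 0}" for s j
  proof (rule finite_imageD)
    show "finite ((+) (Word [s]) ` {w. c s j w \<noteq> 0})"
      by (rule finite_subset[OF _ finite_lookup[of "p j"]]) (auto simp: c_def)
    show "inj_on ((+) (Word [s])) {w. c s j w \<noteq> 0}"
      by (auto simp: inj_on_def plus_fword_def intro: fword.expand)
  qed
  then have "is_left_jacobian p (\<chi> s j. Abs_poly_mapping (c s j))"
    by (simp add: is_left_jacobian_iff c_def plus_fword_def)
  then show "\<exists>J. is_left_jacobian p J" ..
next
  fix J K assume "is_left_jacobian p J" "is_left_jacobian p K"
  then have "Poly_Mapping.lookup (J $ s $ j) (Word w) = Poly_Mapping.lookup (K $ s $ j) (Word w)"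
    for s j w by (simp add: is_left_jacobian_iff)
  then have "J $ s $ j = K $ s $ j" for s j
    by (metis fword.exhaust poly_mapping_eqI)
  then show "J = K"
    by (simp add: Finite_Cartesian_Product.vec_eq_iff)
qed

lemma is_left_jacobian_left_jacobian: "is_left_jacobian p (left_jacobian p)"
  unfolding left_jacobian_def by (rule theI'[OF ex1_left_jacobian])

end

theory Submission
  imports Defs
begin

text \<open>
  Write \<open>J\<close> for the left Jacobian matrix. Evaluating \<open>p\<close> at the bordered tuple with blocks \<open>Y\<^sub>s\<close>, \<open>0\<close>
  in the first and \<open>h\<^sub>s\<close>, \<open>0\<close> in the second block row puts \<open>\<Sum>\<^sub>s h\<^sub>s J\<^sub>s\<^sub>j(Y)\<close> into the lower left corner
  of \<open>p\<^sup>j\<close>, and this is the only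
  place where \<open>h\<close> occurs. So injectivity of \<open>p\<close> implies that \<open>h \<mapsto> h J(Y)\<close> is injective for every tuple \<open>Y\<close> of
  matrices (\<open>jacobian_left_injective\<close>). At the one-dimensional point \<open>0\<close> this makes the constant
  matrix \<open>J(0)\<close> invertible, with inverse \<open>B\<close>.

  A row \<open>f\<close> over the free algebra can be divided by \<open>J\<close> from the right: the row \<open>f - f(0)BJ\<close> has no
  constant term, so that \<open>f = f(0)BJ + \<Sum>\<^sub>i x\<^sub>i T\<^sub>i f\<close>, where \<open>T\<^sub>i f\<close> strips the first letter \<open>x\<^sub>i\<close> from
  \<open>f - f(0)BJ\<close>. If all products of \<open>n\<close> of the operators \<open>T\<^sub>i\<close> kill \<open>f\<close>, then iterating the identity writes
  \<open>f\<close> as \<open>GJ\<close> with a polynomial row \<open>G\<close>. The rows of degree at most \<open>D \<ge> deg J\<close> form a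
  finite-dimensional space that all \<open>T\<^sub>i\<close> preserve and that contains the unit rows, so it suffices
  that the \<open>T\<^sub>i\<close> are jointly nilpotent there.

  If they are not, then the decreasing chain of the spaces spanned by the images of all products of
  \<open>n\<close> operators stabilises at some \<open>U \<noteq> 0\<close> with \<open>U = \<Sum>\<^sub>i T\<^sub>i U\<close>. Expressing a basis of \<open>U\<close> by the
  images of its own members gives matrices \<open>X\<^sub>i\<close> with \<open>e\<^sub>j = \<Sum>\<^sub>i \<Sum>\<^sub>k (X\<^sub>i)\<^sub>j\<^sub>k T\<^sub>i e\<^sub>k\<close>
  (\<open>jointly_nilpotent\<close>). The point is that these structure constants are themselves a matrix point
  at which \<open>J\<close> degenerates: evaluated at the transposes \<open>Y\<^sub>i\<close> of the \<open>X\<^sub>i\<close> and summed up, the division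
  identity of the \<open>e\<^sub>k\<close> leaves \<open>\<Sum>\<^sub>r h\<^sub>r J\<^sub>r\<^sub>s(Y) = 0\<close>, where \<open>h\<^sub>r\<close> collects the coefficients of
  \<open>e\<^sub>k(0)B\<close>. Hence \<open>h = 0\<close>, the operators merely strip letters from the \<open>e\<^sub>k\<close>, and the relation between
  the \<open>e\<^sub>k\<close> forces their degrees to decrease for ever, so that all of them vanish (\<open>no_fixed_family\<close>).

  This yields a left inverse of \<open>J\<close>. It is two-sided because an idempotent matrix over the free
  algebra without constant term is zero (\<open>left_inverse_is_right_inverse\<close>).
\<close>

section \<open>Jointly nilpotent operators\<close>

text \<open>
  The spaces \<open>U n\<close> spanned by the images of all products of \<open>n\<close> operators decrease, hence one of them
  satisfies \<open>U = \<Sum>\<^sub>i T i U\<close>. A basis \<open>e\<close> of it is a solution of the system in \<open>nofix\<close>; as it has no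
  zero member, it is empty and \<open>U = 0\<close>. The shape of \<open>nofix\<close> is chosen so that the coefficients \<open>X i\<close> are square matrices, which can
  be substituted for the indeterminates.
\<close>
lemma (in vector_space) jointly_nilpotent:
  fixes T :: "'i::finite \<Rightarrow> 'b \<Rightarrow> 'b"
  assumes lin: "\<And>i. Vector_Spaces.linear scale scale (T i)"
    and V: "subspace V" "finite S" "V \<subseteq> span S"
    and inv: "\<And>i v. v \<in> V \<Longrightarrow> T i v \<in> V"
    and nofix: "\<And>(N::nat) e X. (\<And>j. j < N \<Longrightarrow> e j \<in> V) \<Longrightarrow>
        (\<And>j. j < N \<Longrightarrow> e j = (\<Sum>i\<in>UNIV. \<Sum>k<N. scale (X i j k) (T i (e k)))) \<Longrightarrow>
        (\<forall>j<N. e j = 0)"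
  shows "\<exists>n. \<forall>w v. length w = n \<longrightarrow> v \<in> V \<longrightarrow> foldr T w v = 0"
proof -
  define F where "F U = {\<Sum>i\<in>UNIV. T i (u i) | u. \<forall>i. u i \<in> U}" for U
  define U where "U n = (F ^^ n) V" for n
  have U0: "U 0 = V" and USuc: "U (Suc n) = F (U n)" for n
    by (simp_all add: U_def)
  have T0: "T i 0 = 0" and Tadd: "T i (x + y) = T i x + T i y" and Tsc: "T i (scale c x) = scale c (T i x)"
    and Tsum: "T i (sum f A) = (\<Sum>a\<in>A. T i (f a))" for i x y c and f :: "'b \<Rightarrow> 'b" and A
    using lin[of i] by (auto simp: Vector_Spaces.linear.axioms linear_iff_module_hom module_hom.zero module_hom.add module_hom.scale module_hom.sum)
  have F_sub: "subspace (F W)" if W: "subspace W" for W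
  proof (rule subspaceI)
    show "0 \<in> F W" unfolding F_def
      using subspace_0[OF W] T0 by (intro CollectI exI[of _ "\<lambda>_. 0"]) simp
  next
    fix x y assume "x \<in> F W" "y \<in> F W"
    then obtain u v where "x = (\<Sum>i\<in>UNIV. T i (u i))" "y = (\<Sum>i\<in>UNIV. T i (v i))"
      "\<forall>i. u i \<in> W" "\<forall>i. v i \<in> W" by (auto simp: F_def)
    then show "x + y \<in> F W" unfolding F_def using subspace_add[OF W]
      by (intro CollectI exI[of _ "\<lambda>i. u i + v i"]) (simp add: Tadd sum.distrib)
  next
    fix c x assume "x \<in> F W"
    then obtain u where "x = (\<Sum>i\<in>UNIV. T i (u i))" "\<forall>i. u i \<in> W" by (auto simp: F_def)
    then show "scale c x \<in> F W" unfolding F_def using subspace_scale[OF W]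
      by (intro CollectI exI[of _ "\<lambda>i. scale c (u i)"]) (simp add: Tsc scale_sum_right)
  qed
  have F_mono: "F W \<subseteq> F W'" if "W \<subseteq> W'" for W W'
    using that by (auto simp: F_def)
  have U_sub: "subspace (U n)" for n
    by (induction n) (simp_all add: U0 USuc V F_sub)
  have "F V \<subseteq> V"
    using inv V(1) by (auto simp: F_def intro: subspace_sum)
  then have U_dec: "U (Suc n) \<subseteq> U n" for n
    by (induction n) (simp_all add: U0 USuc F_mono)
  have U_V: "U n \<subseteq> V" for n
    by (induction n) (use U_dec U0 in blast)+
  \<comment> \<open>A member of least dimension stands in for the first repetition in the chain.\<close>
  obtain n where n: "\<And>m. dim (U n) \<le> dim (U m)"
    using ex_has_least_nat[of "\<lambda>_. True" 0 "\<lambda>n. dim (U n)"] by auto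
  obtain C where C: "C \<subseteq> U (Suc n)" "independent C" "U (Suc n) \<subseteq> span C" "card C = dim (U (Suc n))"
    by (rule basis_exists)
  obtain C' where C': "C' \<subseteq> U n" "independent C'" "U n \<subseteq> span C'" "card C' = dim (U n)"
    by (rule basis_exists)
  have fin: "finite C" "finite C'"
    using independent_span_bound[OF V(2)] C(1,2) C'(1,2) U_V V(3) by (meson subset_trans)+
  have "U n \<subseteq> span C"
  proof (rule ccontr)
    assume "\<not> U n \<subseteq> span C"
    then obtain x where x: "x \<in> U n" "x \<notin> span C" by blast
    then have "independent (insert x C)" by (simp add: independent_insertI C(2))
    moreover have "insert x C \<subseteq> span C'" using x C C' U_dec by blast
    ultimately have "card (insert x C) \<le> card C'"
      using independent_span_bound[OF fin(2)] by blast
    moreover have "x \<notin> C" using x span_base by blast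
    ultimately show False using C(4) C'(4) n[of "Suc n"] fin by simp
  qed
  obtain e where e: "bij_betw e {..<card C} C"
    using ex_bij_betw_nat_finite[OF fin(1)] by (auto simp: atLeast0LessThan)
  have eC: "e j \<in> C" if "j < card C" for j using e that by (auto simp: bij_betw_def)
  have "\<exists>X. j < card C \<longrightarrow> e j = (\<Sum>i\<in>UNIV. \<Sum>k<card C. scale (X i k) (T i (e k)))" for j
  proof (cases "j < card C")
    case True
    have "e j \<in> F (U n)" using eC[OF True] C(1) USuc by auto
    then obtain u where u: "e j = (\<Sum>i\<in>UNIV. T i (u i))" "\<And>i. u i \<in> U n" by (auto simp: F_def)
    have "\<exists>c. u i = (\<Sum>b\<in>C. scale (c b) b)" for i
      using u(2)[of i] \<open>U n \<subseteq> span C\<close> span_finite[OF fin(1)] by auto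
    then obtain c where c: "\<And>i. u i = (\<Sum>b\<in>C. scale (c i b) b)" by metis
    have "T i (u i) = (\<Sum>k<card C. scale (c i (e k)) (T i (e k)))" for i
      unfolding c by (simp add: Tsum Tsc sum.reindex_bij_betw[OF e, of "\<lambda>b. scale (c i b) (T i b)", symmetric])
    then show ?thesis using u(1) by (intro exI[of _ "\<lambda>i k. c i (e k)"]) simp
  qed simp
  then obtain X where "\<And>j. j < card C \<Longrightarrow> e j = (\<Sum>i\<in>UNIV. \<Sum>k<card C. scale (X j i k) (T i (e k)))"
    using choice[of "\<lambda>j X. j < card C \<longrightarrow> e j = (\<Sum>i\<in>UNIV. \<Sum>k<card C. scale (X i k) (T i (e k)))"]
    by blast
  then have "\<forall>j<card C. e j = 0"
    using nofix[of "card C" e "\<lambda>i j k. X j i k"] eC C(1) U_V by blast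
  \<comment> \<open>So \<open>C\<close> spans the zero space, and \<open>U n\<close> lies in it.\<close>
  then have "C \<subseteq> {0}" using e by (auto simp: bij_betw_def)
  then have Un: "U n \<subseteq> {0}" using \<open>U n \<subseteq> span C\<close> span_mono[of C "{0}"] span_0 
    by (metis dual_order.trans span_empty span_insert_0)
  have "foldr T w v \<in> U (length w)" if "v \<in> V" for w v
  proof (induction w)
    case (Cons a w)
    have "foldr T (a # w) v = (\<Sum>i\<in>UNIV. T i (if i = a then foldr T w v else 0))"
      by (simp add: if_distrib T0 cong: if_cong)
    then show ?case using Cons subspace_0[OF U_sub]
      by (auto simp: USuc F_def intro!: exI[of _ "\<lambda>i. if i = a then foldr T w v else 0"])
  qed (simp add: U0 that)
  then have "\<forall>w v. length w = n \<longrightarrow> v \<in> V \<longrightarrow> foldr T w v = 0" using Un by auto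
  then show ?thesis by (rule exI)
qed

section \<open>Coefficients in the free algebra\<close>

abbreviation coef :: "'g free_alg \<Rightarrow> 'g list \<Rightarrow> complex" where
  "coef a w \<equiv> Poly_Mapping.lookup a (Word w)"

abbreviation cst :: "complex \<Rightarrow> 'g free_alg" where
  "cst c \<equiv> Poly_Mapping.single 0 c"

lemma free_alg_eqI:
  assumes "\<And>w. coef a w = coef b w" shows "a = b"
  by (metis assms fword.exhaust poly_mapping_eqI)

lemma coef_cst: "coef (cst c) w = (if w = [] then c else 0)"
  by (auto simp: lookup_single zero_fword_def)

lemma coef_cst_mult: "coef (cst c * a) w = c * coef a w"
  by (simp add: lookup_mult lookup_single when_mult mult_when)

lemma coef_indet_mult:
  "coef (indet s * a) w = (case w of [] \<Rightarrow> 0 | t # v \<Rightarrow> if t = s then coef a v else 0)"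
  by (rule lookup_indet_mult)

lemma coef_Nil_mult: "coef (a * b) [] = coef a [] * coef b []"
proof -
  have "Word [] = l + q \<longleftrightarrow> l = Word [] \<and> q = Word []" for l q :: "'a fword"
    by (cases l; cases q) (auto simp: plus_fword_def)
  then have eq: "(c when Word [] = l + q) = ((c when q = Word []) when l = Word [])"
    for l q :: "'a fword" and c :: complex
    by (simp add: when_def)
  have "(\<Sum>q. coef b [] when q = Word [] when l = Word []) = (coef b [] when l = Word [])"
    for l :: "'a fword"
    by (cases "l = Word []") simp_all
  then have "(\<Sum>q. Poly_Mapping.lookup b q when Word [] = l + q) = (coef b [] when l = Word [])" for l
    unfolding eq by (cases "l = Word []") simp_all
  then show ?thesis by (simp add: lookup_mult mult_when)
qed

definition strip :: "'g \<Rightarrow> 'g free_alg \<Rightarrow> 'g free_alg" where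
  "strip i a = Poly_Mapping.map_key ((+) (Word [i])) a"

lemma coef_strip: "coef (strip i a) w = coef a (i # w)"
proof -
  have "inj ((+) (Word [i]))" by (auto simp: inj_on_def plus_fword_def intro: fword.expand)
  then show ?thesis by (simp add: strip_def map_key.rep_eq plus_fword_def)
qed

section \<open>One-sided inverses over the free algebra\<close>
definition vanishes_below :: "nat \<Rightarrow> 'g free_alg \<Rightarrow> bool" where
  "vanishes_below k a \<longleftrightarrow> (\<forall>w. length w < k \<longrightarrow> coef a w = 0)"

lemma vanishes_below_mult:
  assumes "vanishes_below k a" "vanishes_below l b"
  shows "vanishes_below (k + l) (a * b)"
  unfolding vanishes_below_def
proof (intro allI impI)
  fix w :: "'a list" assume w: "length w < k + l"
  show "coef (a * b) w = 0"
  proof (rule ccontr)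
    assume "coef (a * b) w \<noteq> 0"
    then have "Word w \<in> Poly_Mapping.keys (a * b)" by (simp add: in_keys_iff)
    then obtain u v where "Word w = u + v" "u \<in> Poly_Mapping.keys a" "v \<in> Poly_Mapping.keys b"
      using keys_mult by blast
    then have "w = letters u @ letters v" "coef a (letters u) \<noteq> 0" "coef b (letters v) \<noteq> 0"
      by (auto simp: plus_fword_def in_keys_iff)
    then show False using assms w unfolding vanishes_below_def
      by (metis add_less_le_mono length_append linorder_not_less nat_add_left_cancel_less add_le_mono)
  qed
qed

lemma vanishes_below_sum:
  assumes "\<And>x. x \<in> A \<Longrightarrow> vanishes_below k (f x)" shows "vanishes_below k (sum f A)"
  using assms by (simp add: vanishes_below_def lookup_sum)

lemma matrix_diff_distrib_left:
  fixes A B :: "'a::ring_1 ^ 'n::finite ^ 'm"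
  shows "(A - B) ** C = A ** C - B ** C"
  by (simp add: matrix_matrix_mult_def Finite_Cartesian_Product.vec_eq_iff left_diff_distrib sum_subtractf)

lemma matrix_diff_distrib_right:
  fixes A :: "'a::ring_1 ^ 'n::finite ^ 'm"
  shows "A ** (B - C) = A ** B - A ** C"
  by (simp add: matrix_matrix_mult_def Finite_Cartesian_Product.vec_eq_iff right_diff_distrib sum_subtractf)

text \<open>
  \<open>1 - AG\<close> is idempotent. Its constant term vanishes, since one-sided inverses of complex matrices are
  two-sided. An idempotent whose entries vanish below degree \<open>k \<ge> 1\<close> equals its square, whose entries
  vanish below degree \<open>2k\<close>, so all of its coefficients are zero.
\<close>
lemma left_inverse_is_right_inverse:
  fixes A G :: "'g free_alg ^ 'n::finite ^ 'n"
  assumes GA: "G ** A = Finite_Cartesian_Product.mat 1"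
  shows "A ** G = Finite_Cartesian_Product.mat 1"
proof -
  define F where "F = Finite_Cartesian_Product.mat 1 - A ** G"
  \<comment> \<open>\<open>z\<close> takes the constant terms of the entries and is multiplicative.\<close>
  define z :: "'g free_alg ^ 'n ^ 'n \<Rightarrow> complex ^ 'n ^ 'n" where "z M = (\<chi> i j. coef (M $ i $ j) [])" for M
  have zmult: "z (M ** M') = z M ** z M'" for M M'
    by (simp add: z_def matrix_matrix_mult_def lookup_sum coef_Nil_mult)
  have z1: "z (Finite_Cartesian_Product.mat 1) = Finite_Cartesian_Product.mat 1"
    by (simp add: z_def Finite_Cartesian_Product.mat_def Finite_Cartesian_Product.vec_eq_iff lookup_one zero_fword_def)
  have "z G ** z A = Finite_Cartesian_Product.mat 1" by (metis GA zmult z1)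
  then have "z A ** z G = Finite_Cartesian_Product.mat 1" by (simp add: matrix_left_right_inverse)
  then have zF: "z (A ** G) = z (Finite_Cartesian_Product.mat 1)" by (simp add: zmult z1)
  have c0: "coef (F $ i $ j) [] = 0" for i j
  proof -
    have "z (A ** G) $ i $ j = z (Finite_Cartesian_Product.mat 1) $ i $ j" by (simp add: zF)
    then show ?thesis by (simp add: F_def z_def lookup_minus)
  qed
  have FF: "F ** F = F"
  proof -
    have "A ** G ** (A ** G) = A ** G"
      by (metis GA matrix_mul_assoc matrix_mul_lid)
    then show ?thesis
      by (simp add: F_def matrix_diff_distrib_left matrix_diff_distrib_right)
  qed
  have "\<forall>i j. vanishes_below (Suc n) (F $ i $ j)" for n
  proof (induction n)
    case 0 show ?case by (simp add: vanishes_below_def c0)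
  next
    case (Suc n)
    show ?case
    proof (intro allI)
      fix i j
      have "F $ i $ j = (\<Sum>k\<in>UNIV. F $ i $ k * F $ k $ j)"
        by (subst FF[symmetric]) (simp add: matrix_matrix_mult_def)
      moreover have "vanishes_below (Suc n + Suc n) (\<Sum>k\<in>UNIV. F $ i $ k * F $ k $ j)"
        using Suc by (intro vanishes_below_sum vanishes_below_mult) auto
      ultimately show "vanishes_below (Suc (Suc n)) (F $ i $ j)"
        by (auto simp: vanishes_below_def)
    qed
  qed
  then have "F $ i $ j = 0" for i j
    by (intro free_alg_eqI) (auto simp: vanishes_below_def)
  then have "F = 0" by (simp add: Finite_Cartesian_Product.vec_eq_iff)
  then show ?thesis by (simp add: F_def)
qed

section \<open>Evaluation at matrices\<close>

lemma eval_word_carrier: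
  assumes "X \<in> mat_tuples n" shows "eval_word n X w \<in> carrier_mat n n"
proof -
  have "foldr (\<lambda>s A. X s * A) u (1\<^sub>m n) \<in> carrier_mat n n" for u
    using assms by (induction u) (auto simp: mat_tuples_def intro!: mult_carrier_mat[of _ n n])
  then show ?thesis by (simp add: eval_word_def)
qed

lemma eval_word_Cons_entry:
  assumes X: "X \<in> mat_tuples n" and ij: "i < n" "j < n"
  shows "eval_word n X (Word (s # w)) $$ (i, j) =
    (\<Sum>l<n. X s $$ (i, l) * eval_word n X (Word w) $$ (l, j))"
proof -
  have "X s \<in> carrier_mat n n" using X by (simp add: mat_tuples_def)
  then show ?thesis using eval_word_carrier[OF X, of "Word w"] ij
    by (simp add: eval_word_simps scalar_prod_def atLeast0LessThan)
qed

lemma eval_free_entry_superset: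
  assumes "i < n" "j < n" "finite K" "Poly_Mapping.keys a \<subseteq> K"
  shows "eval_free n X a $$ (i, j) = (\<Sum>w\<in>K. Poly_Mapping.lookup a w * eval_word n X w $$ (i, j))"
proof -
  have "eval_free n X a $$ (i, j) =
      (\<Sum>w\<in>Poly_Mapping.keys a. Poly_Mapping.lookup a w * eval_word n X w $$ (i, j))"
    using assms by (simp add: eval_free_def)
  also have "\<dots> = (\<Sum>w\<in>K. Poly_Mapping.lookup a w * eval_word n X w $$ (i, j))"
    using assms by (intro sum.mono_neutral_left) (auto simp: in_keys_iff)
  finally show ?thesis .
qed

lemma eval_free_zero: "i < n \<Longrightarrow> j < n \<Longrightarrow> eval_free n X 0 $$ (i, j) = 0"
  by (simp add: eval_free_def)

lemma eval_free_add:
  assumes "i < n" "j < n"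
  shows "eval_free n X (a + b) $$ (i, j) = eval_free n X a $$ (i, j) + eval_free n X b $$ (i, j)"
proof -
  let ?K = "Poly_Mapping.keys a \<union> Poly_Mapping.keys b"
  note * = eval_free_entry_superset[OF assms, of ?K]
  show ?thesis
    using keys_add[of a b] by (simp add: * lookup_add distrib_right sum.distrib)
qed

lemma eval_free_sum:
  assumes "i < n" "j < n" "finite A"
  shows "eval_free n X (\<Sum>x\<in>A. f x) $$ (i, j) = (\<Sum>x\<in>A. eval_free n X (f x) $$ (i, j))"
  using assms(3) by induction (simp_all add: eval_free_zero eval_free_add assms)

lemma eval_free_cst_mult:
  assumes "i < n" "j < n"
  shows "eval_free n X (cst c * a) $$ (i, j) = c * eval_free n X a $$ (i, j)"
proof -
  have l: "Poly_Mapping.lookup (cst c * a) w = c * Poly_Mapping.lookup a w" for w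
    using coef_cst_mult[of c a "letters w"] by simp
  then have "Poly_Mapping.keys (cst c * a) \<subseteq> Poly_Mapping.keys a" by (auto simp: in_keys_iff)
  then show ?thesis
    by (simp add: eval_free_entry_superset[OF assms, of "Poly_Mapping.keys a"] l sum_distrib_left mult.assoc)
qed

lemma eval_free_cst:
  assumes "i < n" "j < n"
  shows "eval_free n X (cst c) $$ (i, j) = (if i = j then c else 0)"
  using assms by (simp add: eval_free_entry_superset[of _ _ _ "{0}"] eval_word_simps lookup_single)

lemma eval_free_indet_mult:
  assumes X: "X \<in> mat_tuples n" and ij: "i < n" "j < n"
  shows "eval_free n X (indet s * a) $$ (i, j) = (\<Sum>l<n. X s $$ (i, l) * eval_free n X a $$ (l, j))"
proof -
  let ?f = "\<lambda>w. Word (s # letters w)"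
  let ?K = "Poly_Mapping.keys a"
  have "w \<in> ?f ` ?K" if "Poly_Mapping.lookup (indet s * a) w \<noteq> 0" for w
  proof -
    have "coef (indet s * a) (letters w) \<noteq> 0" using that by simp
    then obtain v where v: "letters w = s # v" "coef a v \<noteq> 0"
      unfolding coef_indet_mult by (cases "letters w") (auto split: if_splits)
    have "w = ?f (Word v)" using v(1) by (cases w) simp
    moreover have "Word v \<in> ?K" using v(2) by (simp add: in_keys_iff)
    ultimately show ?thesis by (rule image_eqI)
  qed
  then have K: "Poly_Mapping.keys (indet s * a) \<subseteq> ?f ` ?K" by (auto simp: in_keys_iff)
  have inj: "inj_on ?f ?K" by (auto simp: inj_on_def intro: fword.expand)
  have "eval_free n X (indet s * a) $$ (i, j) =
      (\<Sum>w\<in>?K. Poly_Mapping.lookup a w * eval_word n X (?f w) $$ (i, j))"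
    by (simp add: eval_free_entry_superset[OF ij _ K] sum.reindex[OF inj] coef_indet_mult)
  also have "\<dots> = (\<Sum>w\<in>?K. \<Sum>l<n. X s $$ (i, l) * (Poly_Mapping.lookup a w * eval_word n X w $$ (l, j)))"
    by (simp add: eval_word_Cons_entry[OF X ij] sum_distrib_left mult.left_commute)
  also have "\<dots> = (\<Sum>l<n. \<Sum>w\<in>?K. X s $$ (i, l) * (Poly_Mapping.lookup a w * eval_word n X w $$ (l, j)))"
    by (rule sum.swap)
  also have "\<dots> = (\<Sum>l<n. X s $$ (i, l) * eval_free n X a $$ (l, j))"
    using ij by (simp add: eval_free_entry_superset[of _ _ _ ?K] sum_distrib_left)
  finally show ?thesis .
qed

section \<open>The Jacobian at matrix points\<close>

text \<open>
  The border is the last row and column, so that the indices below \<open>N\<close> of the inner blocks stay as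
  they are.
\<close>
definition bordered :: "nat \<Rightarrow> ('g \<Rightarrow> nat \<Rightarrow> complex) \<Rightarrow> ('g \<Rightarrow> complex mat) \<Rightarrow> 'g \<Rightarrow> complex mat" where
  "bordered N h Y s = Matrix.mat (Suc N) (Suc N)
     (\<lambda>(a, b). if b = N then 0 else if a = N then h s b else Y s $$ (a, b))"

lemma bordered_mat_tuples: "bordered N h Y \<in> mat_tuples (Suc N)"
  by (simp add: mat_tuples_def bordered_def)

lemma eval_word_bordered:
  assumes Y: "Y \<in> mat_tuples N" and "a < N" "c \<le> N"
  shows "eval_word (Suc N) (bordered N h Y) w $$ (a, c) = (if c = N then 0 else eval_word N Y w $$ (a, c))"
proof -
  have "eval_word (Suc N) (bordered N h Y) (Word u) $$ (a, c) = (if c = N then 0 else eval_word N Y (Word u) $$ (a, c))" for u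
    using assms(2)
  proof (induction u arbitrary: a)
    case Nil
    then show ?case using \<open>c \<le> N\<close> by (simp add: eval_word_def)
  next
    case (Cons s u)
    have "eval_word (Suc N) (bordered N h Y) (Word (s # u)) $$ (a, c) =
        (\<Sum>l<N. Y s $$ (a, l) * eval_word (Suc N) (bordered N h Y) (Word u) $$ (l, c))"
      using Cons.prems \<open>c \<le> N\<close>
      by (simp add: eval_word_Cons_entry[OF bordered_mat_tuples] bordered_def)
    also have "\<dots> = (\<Sum>l<N. Y s $$ (a, l) * (if c = N then 0 else eval_word N Y (Word u) $$ (l, c)))"
      by (simp add: Cons.IH)
    also have "\<dots> = (if c = N then 0 else eval_word N Y (Word (s # u)) $$ (a, c))"
      using Cons.prems \<open>c \<le> N\<close> by (simp add: eval_word_Cons_entry[OF Y])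
    finally show ?case .
  qed
  from this[of "letters w"] show ?thesis by simp
qed

lemma eval_free_bordered:
  assumes "Y \<in> mat_tuples N" "a < N" "c \<le> N"
  shows "eval_free (Suc N) (bordered N h Y) f $$ (a, c) = (if c = N then 0 else eval_free N Y f $$ (a, c))"
  using assms by (simp add: eval_free_def eval_word_bordered)

text \<open>
  The last row of a product that begins with the letter \<open>s\<close> is \<open>h s\<close> times the inner block of the
  remaining product. This is why the Jacobian that splits off the first letter appears.
\<close>
lemma eval_free_bordered_last_row:
  assumes J: "is_left_jacobian p J" and Y: "Y \<in> mat_tuples N" and c: "c \<le> N"
  shows "eval_free (Suc N) (bordered N h Y) (p j) $$ (N, c) =
    (if c = N then coef (p j) [] else \<Sum>s\<in>UNIV. \<Sum>l<N. h s l * eval_free N Y (J $ s $ j) $$ (l, c))"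
proof -
  let ?E = "eval_free (Suc N) (bordered N h Y)"
  have p: "p j = cst (coef (p j) []) + (\<Sum>s\<in>UNIV. indet s * J $ s $ j)"
    using J by (simp add: is_left_jacobian_def const_term_def zero_fword_def)
  have row: "?E (indet s * J $ s $ j) $$ (N, c) =
      (if c = N then 0 else \<Sum>l<N. h s l * eval_free N Y (J $ s $ j) $$ (l, c))" for s
    using c by (simp add: eval_free_indet_mult[OF bordered_mat_tuples] eval_free_bordered[OF Y]
      bordered_def)
  have "?E (p j) $$ (N, c) = ?E (cst (coef (p j) [])) $$ (N, c) +
      (\<Sum>s\<in>UNIV. ?E (indet s * J $ s $ j) $$ (N, c))"
    using c by (subst p) (simp add: eval_free_add eval_free_sum)
  then show ?thesis using c by (simp add: row eval_free_cst)
qed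

text \<open>
  For a row \<open>h\<close> in the kernel, \<open>p\<close> takes the same value at the tuples bordered by \<open>h\<close> and by zero.
\<close>
lemma jacobian_left_injective:
  assumes inj: "inj_on (eval_map p (Suc N)) (mat_tuples (Suc N))"
    and J: "is_left_jacobian p J" and Y: "Y \<in> mat_tuples N"
    and ker: "\<And>j c. c < N \<Longrightarrow> (\<Sum>s\<in>UNIV. \<Sum>l<N. h s l * eval_free N Y (J $ s $ j) $$ (l, c)) = 0"
    and l: "l < N"
  shows "h s l = 0"
proof -
  have "eval_map p (Suc N) (bordered N h Y) = eval_map p (Suc N) (bordered N (\<lambda>_ _. 0) Y)"
  proof
    fix j
    show "eval_map p (Suc N) (bordered N h Y) j = eval_map p (Suc N) (bordered N (\<lambda>_ _. 0) Y) j"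
    proof (rule eq_matI)
      fix a c assume "a < dim_row (eval_map p (Suc N) (bordered N (\<lambda>_ _. 0) Y) j)"
        "c < dim_col (eval_map p (Suc N) (bordered N (\<lambda>_ _. 0) Y) j)"
      then have ac: "a \<le> N" "c \<le> N" by (auto simp: eval_map_def eval_free_def)
      show "eval_map p (Suc N) (bordered N h Y) j $$ (a, c) =
          eval_map p (Suc N) (bordered N (\<lambda>_ _. 0) Y) j $$ (a, c)"
      proof (cases "a = N")
        case True
        then show ?thesis using ac ker[of c j]
          by (simp add: eval_map_def eval_free_bordered_last_row[OF J Y])
      next
        case False
        then show ?thesis using ac by (simp add: eval_map_def eval_free_bordered[OF Y])
      qed
    qed (simp_all add: eval_map_def eval_free_def)
  qed
  then have "bordered N h Y = bordered N (\<lambda>_ _. 0) Y"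
    using inj bordered_mat_tuples by (auto dest: inj_onD)
  then have "bordered N h Y s $$ (N, l) = bordered N (\<lambda>_ _. 0) Y s $$ (N, l)" by simp
  then show ?thesis using l by (simp add: bordered_def)
qed

section \<open>Division of rows by the Jacobian\<close>

definition scale_row :: "complex \<Rightarrow> 'g free_alg ^ 'n \<Rightarrow> 'g free_alg ^ 'n" where
  "scale_row c f = (\<chi> s. cst c * f $ s)"

lemma coef_scale_row: "coef (scale_row c f $ s) w = c * coef (f $ s) w"
  by (simp add: scale_row_def coef_cst_mult)

lemma row_eqI:
  fixes f g :: "'g free_alg ^ 'n"
  assumes "\<And>s w. coef (f $ s) w = coef (g $ s) w" shows "f = g"
  using assms by (auto simp: Finite_Cartesian_Product.vec_eq_iff intro: free_alg_eqI)

lemma vector_space_scale_row: "vector_space scale_row"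
  by unfold_locales (auto intro!: row_eqI simp: coef_scale_row lookup_add algebra_simps)

definition const_row :: "'g free_alg ^ 'n \<Rightarrow> complex ^ 'n" where
  "const_row f = (\<chi> s. coef (f $ s) [])"

definition const_mat :: "'g free_alg ^ 'n ^ 'm \<Rightarrow> complex ^ 'n ^ 'm" where
  "const_mat J = (\<chi> r s. coef (J $ r $ s) [])"

text \<open>
  Stripping of the first letter \<open>i\<close> from \<open>f - cJ\<close>, where the constant row \<open>c = f(0)B\<close> is chosen for \<open>B\<close>
  the inverse of \<open>J(0)\<close>, so that \<open>f - cJ\<close> has no constant term.
\<close>
definition reduce ::
    "complex ^ 'n ^ 'n \<Rightarrow> 'g free_alg ^ 'n ^ 'n \<Rightarrow> 'g \<Rightarrow> 'g free_alg ^ 'n \<Rightarrow> 'g free_alg ^ 'n" where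
  "reduce B J i f = (\<chi> s. strip i (f $ s) - (\<Sum>r\<in>UNIV. cst ((const_row f v* B) $ r) * strip i (J $ r $ s)))"

lemma coef_reduce:
  "coef (reduce B J i f $ s) w =
     coef (f $ s) (i # w) - (\<Sum>r\<in>UNIV. (const_row f v* B) $ r * coef (J $ r $ s) (i # w))"
  by (simp add: reduce_def lookup_minus lookup_sum coef_cst_mult coef_strip)

lemma reduce_decomposition:
  fixes f :: "('g::finite) free_alg ^ 'n::finite"
  assumes B: "B ** const_mat J = Finite_Cartesian_Product.mat 1"
  shows "f $ s = (\<Sum>r\<in>UNIV. cst ((const_row f v* B) $ r) * J $ r $ s) +
    (\<Sum>i\<in>UNIV. indet i * reduce B J i f $ s)"
proof (rule free_alg_eqI)
  fix w
  have "(const_row f v* B) v* const_mat J = const_row f"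
    by (simp add: vector_matrix_mul_assoc B)
  then have c: "(\<Sum>r\<in>UNIV. (const_row f v* B) $ r * coef (J $ r $ s) []) = coef (f $ s) []"
    by (simp add: const_mat_def const_row_def Finite_Cartesian_Product.vec_eq_iff vector_matrix_mult_def)
  show "coef (f $ s) w = coef ((\<Sum>r\<in>UNIV. cst ((const_row f v* B) $ r) * J $ r $ s) +
    (\<Sum>i\<in>UNIV. indet i * reduce B J i f $ s)) w"
    by (cases w) (simp_all add: lookup_add lookup_sum coef_cst_mult coef_indet_mult c coef_reduce)
qed

lemma linear_reduce: "Vector_Spaces.linear scale_row scale_row (reduce B J i)"
proof -
  interpret vector_space scale_row by (rule vector_space_scale_row)
  have add: "const_row (f + g) v* B = const_row f v* B + const_row g v* B" for f g
    by (simp add: const_row_def vector_matrix_mult_def Finite_Cartesian_Product.vec_eq_iff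
      lookup_add distrib_right sum.distrib)
  have scl: "const_row (scale_row c f) v* B = c *s (const_row f v* B)" for c f
    by (simp add: const_row_def vector_matrix_mult_def Finite_Cartesian_Product.vec_eq_iff
      coef_scale_row sum_distrib_left mult.assoc)
  show ?thesis
    unfolding Vector_Spaces.linear_iff
    by (auto intro!: row_eqI vector_space_scale_row
      simp: add scl coef_reduce coef_scale_row lookup_add distrib_right sum.distrib
        right_diff_distrib sum_distrib_left mult.assoc)
qed

definition rows_upto :: "nat \<Rightarrow> ('g free_alg ^ 'n) set" where
  "rows_upto D = {f. \<forall>s w. D < length w \<longrightarrow> coef (f $ s) w = 0}"

lemma rows_upto_subspace: "module.subspace scale_row (rows_upto D)"
proof -
  interpret vector_space scale_row by (rule vector_space_scale_row)
  show ?thesis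
    by (rule subspaceI) (auto simp: rows_upto_def lookup_add coef_scale_row)
qed

text \<open>
  The indeterminates being finite in number, the unit rows multiplied by the words of length at most
  \<open>D\<close> form a finite spanning set.
\<close>
lemma rows_upto_finitely_spanned:
  obtains S :: "(('g::finite) free_alg ^ 'n::finite) set"
  where "finite S" "rows_upto D \<subseteq> module.span scale_row S"
proof
  interpret vector_space scale_row by (rule vector_space_scale_row)
  let ?e = "\<lambda>(s, w). axis s (Poly_Mapping.single (Word w) 1) :: 'g free_alg ^ 'n"
  let ?W = "UNIV \<times> {w :: 'g list. length w \<le> D}"
  have fin: "finite {w :: 'g list. length w \<le> D}"
    using finite_lists_length_le[of "UNIV :: 'g set" D] by simp
  then show "finite (?e ` ?W)" by simp
  show "rows_upto D \<subseteq> module.span scale_row (?e ` ?W)"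
  proof
    fix f :: "'g free_alg ^ 'n" assume f: "f \<in> rows_upto D"
    have "f = (\<Sum>s\<in>UNIV. \<Sum>w | length w \<le> D. scale_row (coef (f $ s) w) (?e (s, w)))"
    proof (rule row_eqI)
      fix t u
      have "coef ((\<Sum>s\<in>UNIV. \<Sum>w | length w \<le> D. scale_row (coef (f $ s) w) (?e (s, w))) $ t) u
        = (\<Sum>s\<in>UNIV. \<Sum>w | length w \<le> D. if s = t then if w = u then coef (f $ s) w else 0 else 0)"
        by (auto simp: lookup_sum coef_scale_row axis_def lookup_single when_def intro!: sum.cong)
      also have "\<dots> = (\<Sum>s\<in>UNIV. if s = t then \<Sum>w | length w \<le> D. if w = u then coef (f $ s) w else 0 else 0)"
        by (intro sum.cong) auto
      also have "\<dots> = coef (f $ t) u"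
        using f fin by (auto simp: rows_upto_def)
      finally show "coef (f $ t) u = coef ((\<Sum>s\<in>UNIV. \<Sum>w | length w \<le> D.
          scale_row (coef (f $ s) w) (?e (s, w))) $ t) u" by simp
    qed
    moreover have "\<dots> \<in> span (?e ` ?W)"
      by (intro span_sum span_scale span_base) auto
    ultimately show "f \<in> span (?e ` ?W)" by metis
  qed
qed

lemma entries_degree_bound:
  fixes J :: "('g::finite) free_alg ^ 'n::finite ^ 'm::finite"
  obtains D where "\<And>r s w. D < length w \<Longrightarrow> coef (J $ r $ s) w = 0"
proof
  let ?L = "\<Union>r s. (length \<circ> letters) ` Poly_Mapping.keys (J $ r $ s)"
  fix r s and w :: "'g list" assume w: "Max ?L < length w"
  show "coef (J $ r $ s) w = 0"
  proof (rule ccontr)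
    assume "coef (J $ r $ s) w \<noteq> 0"
    then have "Word w \<in> Poly_Mapping.keys (J $ r $ s)" by (simp add: in_keys_iff)
    then have "length w \<in> ?L" by force
    moreover have "finite ?L" by auto
    ultimately show False using w Max_ge by (metis linorder_not_less)
  qed
qed

text \<open>
  Induction on \<open>n\<close>: if each \<open>reduce B J i f\<close> is a multiple \<open>g i v* J\<close>, then the division identity
  exhibits \<open>f\<close> as a multiple of \<open>J\<close>.
\<close>
lemma left_divisible_if_reduce_nilpotent:
  fixes J :: "('g::finite) free_alg ^ 'n::finite ^ 'n"
  assumes B: "B ** const_mat J = Finite_Cartesian_Product.mat 1"
  shows "(\<And>w. length w = n \<Longrightarrow> foldr (reduce B J) w f = 0) \<Longrightarrow> \<exists>g. f = g v* J"
proof (induction n arbitrary: f)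
  case 0
  then have "f = 0" by simp
  then show ?case by (intro exI[of _ 0]) (simp add: vector_matrix_mult_def Finite_Cartesian_Product.vec_eq_iff)
next
  case (Suc n)
  have "\<exists>g. reduce B J i f = g v* J" for i
  proof (rule Suc.IH)
    fix w :: "'g list" assume "length w = n"
    then show "foldr (reduce B J) w (reduce B J i f) = 0"
      using Suc.prems[of "w @ [i]"] by simp
  qed
  then obtain g where g: "\<And>i. reduce B J i f = g i v* J" by metis
  let ?g = "\<chi> r. cst ((const_row f v* B) $ r) + (\<Sum>i\<in>UNIV. indet i * g i $ r)"
  have "f $ s = (?g v* J) $ s" for s
  proof -
    have "f $ s = (\<Sum>r\<in>UNIV. cst ((const_row f v* B) $ r) * J $ r $ s) +
        (\<Sum>i\<in>UNIV. \<Sum>r\<in>UNIV. indet i * g i $ r * J $ r $ s)"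
      by (subst reduce_decomposition[OF B]) (simp add: g vector_matrix_mult_def sum_distrib_left mult.assoc)
    also have "(\<Sum>i\<in>UNIV. \<Sum>r\<in>UNIV. indet i * g i $ r * J $ r $ s) =
        (\<Sum>r\<in>UNIV. \<Sum>i\<in>UNIV. indet i * g i $ r * J $ r $ s)"
      by (rule sum.swap)
    finally show ?thesis
      by (simp add: vector_matrix_mult_def distrib_right sum_distrib_right sum.distrib)
  qed
  then show ?case by (auto simp: Finite_Cartesian_Product.vec_eq_iff)
qed

section \<open>Invertibility of the Jacobian\<close>

text \<open>
  Write \<open>T\<^sub>i\<close> for \<open>reduce B J i\<close> and evaluate at the transposes \<open>Y\<^sub>i\<close> of the coefficient matrices \<open>X\<^sub>i\<close>. The
  \<open>k\<close>-th row of the value of \<open>x\<^sub>i T\<^sub>i e\<^sub>k\<close> is the sum over \<open>l\<close> of \<open>(X\<^sub>i)\<^sub>l\<^sub>k\<close> times the \<open>l\<close>-th row of the value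
  of \<open>T\<^sub>i e\<^sub>k\<close>. By \<open>fix_e\<close>, summing this over \<open>i\<close> and \<open>k\<close> gives the sum over \<open>l\<close> of the \<open>l\<close>-th rows of the
  values of \<open>e\<^sub>l\<close>. So if the division identity of \<open>e\<^sub>k\<close> is evaluated, its \<open>k\<close>-th row is taken and the
  results are added, then everything cancels except the multiple of \<open>J\<close>, and \<open>inj\<close> applies to it.
\<close>
lemma no_fixed_family:
  fixes J :: "('g::finite) free_alg ^ 'n::finite ^ 'n" and e :: "nat \<Rightarrow> 'g free_alg ^ 'n"
  assumes B: "B ** const_mat J = Finite_Cartesian_Product.mat 1"
    and inj: "\<And>Y h s l. Y \<in> mat_tuples N \<Longrightarrow>
      (\<And>j c. c < N \<Longrightarrow> (\<Sum>s\<in>UNIV. \<Sum>l<N. h s l * eval_free N Y (J $ s $ j) $$ (l, c)) = 0) \<Longrightarrow>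
      l < N \<Longrightarrow> h s l = 0"
    and e: "\<And>j. j < N \<Longrightarrow> e j \<in> rows_upto D"
    and fix_e: "\<And>j. j < N \<Longrightarrow> e j = (\<Sum>i\<in>UNIV. \<Sum>k<N. scale_row (X i j k) (reduce B J i (e k)))"
    and j: "j < N"
  shows "e j = 0"
proof -
  define Y where "Y i = Matrix.mat N N (\<lambda>(k, l). X i l k)" for i
  define h where "h r k = (const_row (e k) v* B) $ r" for r k
  let ?E = "\<lambda>a k c. eval_free N Y a $$ (k, c)"
  have Y: "Y \<in> mat_tuples N" by (simp add: Y_def mat_tuples_def)
  have ker: "(\<Sum>r\<in>UNIV. \<Sum>k<N. h r k * ?E (J $ r $ s) k c) = 0" if c: "c < N" for s c
  proof -
    have decomp: "?E (e k $ s) k c = (\<Sum>r\<in>UNIV. h r k * ?E (J $ r $ s) k c) +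
        (\<Sum>i\<in>UNIV. \<Sum>l<N. X i l k * ?E (reduce B J i (e k) $ s) l c)" if k: "k < N" for k
      using k c
      by (subst reduce_decomposition[OF B])
        (simp add: eval_free_add eval_free_sum eval_free_cst_mult eval_free_indet_mult[OF Y] h_def Y_def)
    have fixed: "?E (e l $ s) l c = (\<Sum>i\<in>UNIV. \<Sum>k<N. X i l k * ?E (reduce B J i (e k) $ s) l c)"
      if l: "l < N" for l
      using l c
      by (subst fix_e) (simp_all add: scale_row_def eval_free_sum eval_free_cst_mult)
    have "(\<Sum>k<N. ?E (e k $ s) k c) = (\<Sum>k<N. \<Sum>r\<in>UNIV. h r k * ?E (J $ r $ s) k c) +
        (\<Sum>k<N. \<Sum>i\<in>UNIV. \<Sum>l<N. X i l k * ?E (reduce B J i (e k) $ s) l c)"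
      by (simp add: decomp sum.distrib)
    also have "(\<Sum>k<N. \<Sum>i\<in>UNIV. \<Sum>l<N. X i l k * ?E (reduce B J i (e k) $ s) l c) =
        (\<Sum>i\<in>UNIV. \<Sum>k<N. \<Sum>l<N. X i l k * ?E (reduce B J i (e k) $ s) l c)"
      by (rule sum.swap)
    also have "\<dots> = (\<Sum>i\<in>UNIV. \<Sum>l<N. \<Sum>k<N. X i l k * ?E (reduce B J i (e k) $ s) l c)"
      by (intro sum.cong refl sum.swap)
    also have "\<dots> = (\<Sum>l<N. \<Sum>i\<in>UNIV. \<Sum>k<N. X i l k * ?E (reduce B J i (e k) $ s) l c)"
      by (rule sum.swap)
    also have "\<dots> = (\<Sum>l<N. ?E (e l $ s) l c)"
      by (simp add: fixed)
    also have "(\<Sum>k<N. \<Sum>r\<in>UNIV. h r k * ?E (J $ r $ s) k c) =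
        (\<Sum>r\<in>UNIV. \<Sum>k<N. h r k * ?E (J $ r $ s) k c)"
      by (rule sum.swap)
    finally show ?thesis by simp
  qed
  \<comment> \<open>Since the constant rows \<open>h\<close> vanish, \<open>reduce\<close> only strips a letter from each \<open>e k\<close>.\<close>
  have h0: "h r k = 0" if "k < N" for r k
    using inj[OF Y ker that] .
  have step: "coef (e j $ s) w = (\<Sum>i\<in>UNIV. \<Sum>k<N. X i j k * coef (e k $ s) (i # w))"
    if "j < N" for j s w
    by (subst fix_e[OF that])
      (simp add: lookup_sum coef_scale_row coef_reduce h0[unfolded h_def])
  \<comment> \<open>A coefficient of \<open>e j\<close> at a word depends on coefficients at words that are longer by one,
    and those beyond length \<open>D\<close> are zero.\<close>
  have descent: "\<forall>j<N. \<forall>s w. D < length w + m \<longrightarrow> coef (e j $ s) w = 0" for m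
  proof (induction m)
    case 0
    then show ?case using e by (auto simp: rows_upto_def)
  next
    case (Suc m)
    show ?case
    proof (intro allI impI)
      fix j s and w :: "'g list" assume "j < N" "D < length w + Suc m"
      then show "coef (e j $ s) w = 0"
        using Suc.IH by (subst step) simp_all
    qed
  qed
  have "coef (e j $ s) w = 0" for s w
    using descent[of "Suc D"] j by simp
  then show ?thesis by (intro row_eqI) simp
qed

lemma eval_free_at_zero:
  "eval_free 1 (\<lambda>_. 0\<^sub>m 1 1) a $$ (0, 0) = coef a []"
proof -
  have w: "eval_word 1 (\<lambda>_. 0\<^sub>m 1 1) w $$ (0, 0) = (if w = 0 then 1 else 0)" for w :: "'a fword"
  proof (cases w)
    case (Word u)
    have Z: "(\<lambda>_. 0\<^sub>m 1 1) \<in> mat_tuples 1" by (simp add: mat_tuples_def)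
    show ?thesis
    proof (cases u)
      case Nil
      then show ?thesis by (simp add: Word eval_word_def zero_fword_def)
    next
      case (Cons s v)
      have "eval_word 1 (\<lambda>_. 0\<^sub>m 1 1) (Word (s # v)) $$ (0, 0) = 0"
        by (subst eval_word_Cons_entry[OF Z]) simp_all
      then show ?thesis using Cons Word by (simp add: zero_fword_def)
    qed
  qed
  have "eval_free 1 (\<lambda>_. 0\<^sub>m 1 1) a $$ (0, 0) =
      (\<Sum>w\<in>insert 0 (Poly_Mapping.keys a). Poly_Mapping.lookup a w * (if w = 0 then 1 else 0))"
    unfolding w[symmetric] by (rule eval_free_entry_superset) auto
  also have "\<dots> = Poly_Mapping.lookup a 0"
    by (subst sum.mono_neutral_right[of _ "{0}"]) auto
  finally show ?thesis by (simp add: zero_fword_def)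
qed

text \<open>
  The one-dimensional point \<open>0\<close> is bordered to matrices of size two, where injectivity of \<open>p\<close> applies.
\<close>
lemma jacobian_const_left_invertible:
  fixes p :: "'g::finite \<Rightarrow> 'g free_alg"
  assumes inj: "inj_on (eval_map p 2) (mat_tuples 2)" and J: "is_left_jacobian p J"
  shows "\<exists>B. B ** const_mat J = Finite_Cartesian_Product.mat 1"
proof -
  have "x = 0" if "transpose (const_mat J) *v x = 0" for x
  proof -
    have "(\<Sum>s\<in>UNIV. \<Sum>l<1. x $ s * eval_free 1 (\<lambda>_. 0\<^sub>m 1 1) (J $ s $ j) $$ (l, c)) = 0"
      if "c < 1" for j c
    proof -
      have "(transpose (const_mat J) *v x) $ j = 0"
        using \<open>transpose (const_mat J) *v x = 0\<close> by simp
      then show ?thesis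
        using that by (simp add: eval_free_at_zero[simplified] matrix_vector_mult_def
          Finite_Cartesian_Product.transpose_def const_mat_def mult.commute)
    qed
    then have "x $ s = 0" for s
      using jacobian_left_injective[OF inj[unfolded numeral_2_eq_2] J, where Y = "\<lambda>_. 0\<^sub>m 1 1"
        and h = "\<lambda>s _. x $ s" and s = s and l = 0]
      by (simp add: mat_tuples_def)
    then show ?thesis by (simp add: Finite_Cartesian_Product.vec_eq_iff)
  qed
  then have "\<exists>C. C ** transpose (const_mat J) = Finite_Cartesian_Product.mat 1"
    unfolding matrix_left_invertible_ker by blast
  then have "\<exists>C. const_mat J ** C = Finite_Cartesian_Product.mat 1"
    unfolding left_invertible_transpose .
  then show ?thesis
    using matrix_left_right_inverse by blast
qed

theorem theorem3p17:
  fixes p :: "'g::finite \<Rightarrow> 'g free_alg"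
  assumes "bijective_free_map p"
  shows "invertible (left_jacobian p)"
proof -
  let ?J = "left_jacobian p"
  have inj: "inj_on (eval_map p (Suc N)) (mat_tuples (Suc N))" for N
    using assms by (auto simp: bijective_free_map_def bij_betw_def)
  note J = is_left_jacobian_left_jacobian[of p]
  obtain B where B: "B ** const_mat ?J = Finite_Cartesian_Product.mat 1"
    using jacobian_const_left_invertible[OF _ J] inj[of 1] unfolding Suc_1 by blast
  obtain D where D: "\<And>r s w. D < length w \<Longrightarrow> coef (?J $ r $ s) w = 0"
    using entries_degree_bound[of ?J] by blast
  obtain S :: "('g free_alg ^ 'g) set" where S: "finite S" "rows_upto D \<subseteq> module.span scale_row S"
    by (rule rows_upto_finitely_spanned)
  have "\<exists>n. \<forall>w f. length w = n \<longrightarrow> f \<in> rows_upto D \<longrightarrow> foldr (reduce B ?J) w f = 0"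
  proof (rule vector_space.jointly_nilpotent[OF vector_space_scale_row linear_reduce
        rows_upto_subspace S])
    show "reduce B ?J i v \<in> rows_upto D" if "v \<in> rows_upto D" for i v
      using that D by (simp add: rows_upto_def coef_reduce)
    show "\<forall>j<N. e j = 0"
      if e: "\<And>j. j < N \<Longrightarrow> e j \<in> rows_upto D"
        "\<And>j. j < N \<Longrightarrow> e j = (\<Sum>i\<in>UNIV. \<Sum>k<N. scale_row (X i j k) (reduce B ?J i (e k)))"
      for N X and e :: "nat \<Rightarrow> 'g free_alg ^ 'g"
    proof (intro allI impI)
      fix j assume "j < N"
      show "e j = 0"
      proof (rule no_fixed_family[where N = N and D = D and X = X, OF B])
        show "h s l = 0" if "Y \<in> mat_tuples N"
          "\<And>j c. c < N \<Longrightarrow> (\<Sum>s\<in>UNIV. \<Sum>l<N. h s l * eval_free N Y (?J $ s $ j) $$ (l, c)) = 0"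
          "l < N" for Y h s l
          by (rule jacobian_left_injective[where h = h, OF inj J that])
      qed (fact e \<open>j < N\<close>)+
    qed
  qed
  then obtain n where n: "\<And>w f. length w = n \<Longrightarrow> f \<in> rows_upto D \<Longrightarrow> foldr (reduce B ?J) w f = 0"
    by blast
  have "axis s 1 \<in> rows_upto D" for s
    by (auto simp: rows_upto_def axis_def lookup_one zero_fword_def when_def)
  then have "\<exists>g. axis s 1 = g v* ?J" for s
    by (intro left_divisible_if_reduce_nilpotent[OF B, of n] n)
  then obtain g where g: "\<And>s. axis s 1 = g s v* ?J" by metis
  have "(\<Sum>r\<in>UNIV. g s $ r * ?J $ r $ j) = (if s = j then 1 else 0)" for s j
    using arg_cong[OF g[of s], of "\<lambda>v. v $ j"] by (auto simp: vector_matrix_mult_def axis_def)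
  then have "(\<chi> s. g s) ** ?J = Finite_Cartesian_Product.mat 1"
    by (simp add: Finite_Cartesian_Product.vec_eq_iff matrix_matrix_mult_def
      Finite_Cartesian_Product.mat_def)
  moreover from this have "?J ** (\<chi> s. g s) = Finite_Cartesian_Product.mat 1"
    by (rule left_inverse_is_right_inverse)
  ultimately show ?thesis
    unfolding invertible_def by (intro exI[of _ "\<chi> s. g s"] conjI)
qed

end
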